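(* Let $(B,+,\circ)$ be a near brace, and let $\check r^*,\check r:B\times B\to B\times B$, $\check r^*:(x,y)\mapsto(\hat\sigma^p_x(y),\hat\tau^p_y(x))$, $\check r:(x,y)\mapsto(\sigma^p_x(y),\tau^p_y(x))$, be solutions of the braid equation. Then the following hold. (1) $\check r^*=\check r^{-1}$ if and only if for all $x,y\in B$ $$\hat\sigma^p_{\sigma^p_x(y)}(\tau^p_y(x))=x,\quad \hat\tau^p_{\tau^p_y(x)}(\sigma^p_x(y))=y,\quad \sigma^p_{\hat\sigma^p_x(y)}(\hat\tau^p_y(x))=x,\quad \tau^p_{\hat\tau^p_y(x)}(\hat\sigma^p_x(y))=y.$$ (2) Suppose $\sigma^p_x(y)=x\circ y\circ z_1-x\circ\xi+z_2$ and $\tau^p_y(x)=\sigma^p_x(y)^{-1}\circ x\circ y$, where $\xi,z_1,z_2\in B$ are fixed elements such that there exist $c_1,c_2\in B$ such that for all $a,b,c\in B$: $(a-b+c)\circ z_i=a\circ z_i-b\circ z_i+c\circ z_i$ for $i\in\{1,2\}$, $a\circ z_2\circ z_1-a\circ\xi=c_1$, and $-a\circ\xi+a\circ z_1\circ z_2=c_2$. Then the inverse of $\check r$ is the map $\check r^{-1}(x,y)=(\hat\sigma^p_x(y),\hat\tau^p_y(x))$ with $$\hat\sigma^p_x(y)=\hat z_2-x\circ\hat\xi+x\circ y\circ\hat z_1,\qquad \hat\tau^p_y(x)=\hat\sigma^p_x(y)^{-1}\circ x\circ y,$$ where $\hat\xi=\xi^{-1}$, $\hat z_1=z_1\circ\xi^{-1}$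 and $\hat z_2=z_2\circ\xi^{-1}$.
   Context: A near brace is a set $B$ with two group operations $+$ and $\circ$ (neither necessarily abelian) such that for all $a,b,c\in B$, $a\circ(b+c)=a\circ b-a\circ 0+a\circ c$, where $0$ is the neutral element of $(B,+)$ and $1$ that of $(B,\circ)$. Here $\circ$ binds more tightly than $+,-$; $-a$ is the inverse in $(B,+)$ and $a^{-1}$ the inverse in $(B,\circ)$. A map $\check r:B\times B\to B\times B$ is a solution of the braid equation if $(\check r\times\mathrm{id})(\mathrm{id}\times\check r)(\check r\times\mathrm{id})=(\mathrm{id}\times\check r)(\check r\times\mathrm{id})(\mathrm{id}\times\check r)$ on $B\times B\times B$. *)

theory Defs
  imports "HOL-Algebra.Ring"
begin

text \<open>
  The record type for rings is used only as a carrier with two operations: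
  \<open>\<oplus>\<close> is the near brace addition with neutral element \<open>\<zero>\<close>, and \<open>\<otimes>\<close> is the operation
  written \<open>\<circ>\<close> in the literature, with neutral element \<open>\<one>\<close>.
  Neither operation is assumed commutative, and \<open>\<zero>\<close> and \<open>\<one>\<close> may differ.
  Here \<open>\<ominus>\<close> is the inverse in the additive group, with \<open>a \<ominus> b = a \<oplus> (\<ominus> b)\<close>,
  and \<open>inv\<close> is the inverse with respect to \<open>\<otimes>\<close>.
\<close>

locale near_brace =
  fixes B (structure)
  assumes add_group: "group (add_monoid B)"
    and mult_group: "group B"
    and near_distrib:
      "\<lbrakk>a \<in> carrier B; b \<in> carrier B; c \<in> carrier B\<rbrakk>
        \<Longrightarrow> a \<otimes> (b \<oplus> c) = a \<otimes> b \<ominus> a \<otimes> \<zero> \<oplus> a \<otimes> c"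

definition times_id :: "('a \<times> 'a \<Rightarrow> 'a \<times> 'a) \<Rightarrow> 'a \<times> 'a \<times> 'a \<Rightarrow> 'a \<times> 'a \<times> 'a" where
  "times_id r = (\<lambda>(x, y, z). let (u, v) = r (x, y) in (u, v, z))"

definition id_times :: "('a \<times> 'a \<Rightarrow> 'a \<times> 'a) \<Rightarrow> 'a \<times> 'a \<times> 'a \<Rightarrow> 'a \<times> 'a \<times> 'a" where
  "id_times r = (\<lambda>(x, y, z). let (u, v) = r (y, z) in (x, u, v))"

definition braid_solution :: "'a set \<Rightarrow> ('a \<times> 'a \<Rightarrow> 'a \<times> 'a) \<Rightarrow> bool" where
  "braid_solution X r \<longleftrightarrow>
     r \<in> X \<times> X \<rightarrow> X \<times> X \<and>
     (\<forall>t \<in> X \<times> X \<times> X.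
        (times_id r \<circ> id_times r \<circ> times_id r) t = (id_times r \<circ> times_id r \<circ> id_times r) t)"

text \<open>
  \<open>g\<close> is the inverse of \<open>f : S \<rightarrow> S\<close>. Bijectivity is part of the claim, and values
  outside \<open>S\<close> are ignored.
\<close>

definition is_inverse_map_on :: "'s set \<Rightarrow> ('s \<Rightarrow> 's) \<Rightarrow> ('s \<Rightarrow> 's) \<Rightarrow> bool" where
  "is_inverse_map_on S f g \<longleftrightarrow> bij_betw f S S \<and> (\<forall>s \<in> S. g s = inv_into S f s)"

end

theory Submission
  imports Defs
begin

text \<open>
  The map \<open>r\<close> preserves the product: \<open>\<sigma> x y \<otimes> \<tau> y x = x \<otimes> y\<close>, and so does the claimed inverse.
  Hence in each composite the second component is correct as soon as the first one is.
  For the first component, the relation \<open>a \<otimes> \<xi> = \<ominus> c1 \<oplus> a \<otimes> z2 \<otimes> z1\<close> makes right multiplication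
  by \<open>\<xi>\<close>, and then by \<open>inv \<xi>\<close>, compatible with \<open>a \<ominus> b \<oplus> c\<close>, because the constant \<open>c1\<close> cancels;
  after this distribution everything but \<open>x\<close> telescopes.
\<close>

text \<open>Replaces \<open>inv_into\<close> by the two composition identities, the form in which
  both claims of the theorem are checked; for maps from \<open>S\<close> to itself these already
  give bijectivity.\<close>

lemma is_inverse_map_on_iff:
  assumes "f \<in> S \<rightarrow> S" "g \<in> S \<rightarrow> S"
  shows "is_inverse_map_on S f g \<longleftrightarrow> (\<forall>s \<in> S. g (f s) = s \<and> f (g s) = s)"
proof
  assume "is_inverse_map_on S f g"
  then have bij: "bij_betw f S S" and g: "\<And>s. s \<in> S \<Longrightarrow> g s = inv_into S f s"
    by (auto simp: is_inverse_map_on_def)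
  show "\<forall>s \<in> S. g (f s) = s \<and> f (g s) = s"
    using bij_betw_inv_into_left[OF bij] bij_betw_inv_into_right[OF bij] g assms(1)
    by (auto simp: Pi_iff)
next
  assume inv: "\<forall>s \<in> S. g (f s) = s \<and> f (g s) = s"
  then have bij: "bij_betw f S S"
    using assms by (intro bij_betwI[where g = g]) auto
  moreover have "g s = inv_into S f s" if "s \<in> S" for s
    using that inv assms bij
    by (metis PiE bij_betw_imp_inj_on inv_into_f_f)
  ultimately show "is_inverse_map_on S f g"
    by (simp add: is_inverse_map_on_def)
qed

context near_brace
begin

sublocale add: group "add_monoid B"
  rewrites "carrier (add_monoid B) = carrier B"
    and "mult (add_monoid B) = add B"
    and "one (add_monoid B) = zero B"
    and "m_inv (add_monoid B) = a_inv B"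
  by (simp_all add: add_group a_inv_def)

sublocale group B
  by (rule mult_group)

lemma minus_in_carrier [simp]:
  "\<lbrakk>a \<in> carrier B; b \<in> carrier B\<rbrakk> \<Longrightarrow> a \<ominus> b \<in> carrier B"
  by (simp add: a_minus_def)

text \<open>Once sums are associated to the right, an opposite pair sits in front of a tail. These
  rules delete it there, so that simp can finish telescoping sums without commutativity.\<close>

lemma minus_cancel_left [simp]:
  "\<lbrakk>a \<in> carrier B; b \<in> carrier B\<rbrakk> \<Longrightarrow> \<ominus> a \<oplus> (a \<oplus> b) = b"
  "\<lbrakk>a \<in> carrier B; b \<in> carrier B\<rbrakk> \<Longrightarrow> a \<oplus> (\<ominus> a \<oplus> b) = b"
  by (simp_all flip: add.m_assoc)

lemma mult_cancel_left [simp]: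
  "\<lbrakk>a \<in> carrier B; b \<in> carrier B\<rbrakk> \<Longrightarrow> inv a \<otimes> (a \<otimes> b) = b"
  "\<lbrakk>a \<in> carrier B; b \<in> carrier B\<rbrakk> \<Longrightarrow> a \<otimes> (inv a \<otimes> b) = b"
  by (simp_all flip: m_assoc)

text \<open>Right multiplication by \<open>z\<close> is an endomorphism of the heap of the additive
  group, whose ternary operation is \<open>a \<ominus> b \<oplus> c\<close>.\<close>

definition right_truss_distrib :: "'a \<Rightarrow> bool" where
  "right_truss_distrib z \<longleftrightarrow>
     (\<forall>a \<in> carrier B. \<forall>b \<in> carrier B. \<forall>c \<in> carrier B.
        (a \<ominus> b \<oplus> c) \<otimes> z = a \<otimes> z \<ominus> b \<otimes> z \<oplus> c \<otimes> z)"

lemma right_truss_distribD: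
  "\<lbrakk>right_truss_distrib z; a \<in> carrier B; b \<in> carrier B; c \<in> carrier B\<rbrakk>
    \<Longrightarrow> (a \<ominus> b \<oplus> c) \<otimes> z = a \<otimes> z \<ominus> b \<otimes> z \<oplus> c \<otimes> z"
  by (simp add: right_truss_distrib_def)

lemma right_truss_distrib_mult:
  assumes "right_truss_distrib z" "right_truss_distrib w" "z \<in> carrier B" "w \<in> carrier B"
  shows "right_truss_distrib (z \<otimes> w)"
  using assms by (simp add: right_truss_distrib_def flip: m_assoc)

text \<open>Right multiplication by \<open>inv z\<close> is the inverse of a bijective heap
  endomorphism, hence one itself.\<close>

lemma right_truss_distrib_inv:
  assumes z: "right_truss_distrib z" "z \<in> carrier B"
  shows "right_truss_distrib (inv z)"
  unfolding right_truss_distrib_def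
proof (intro ballI)
  fix a b c
  assume abc: "a \<in> carrier B" "b \<in> carrier B" "c \<in> carrier B"
  let ?h = "a \<otimes> inv z \<ominus> b \<otimes> inv z \<oplus> c \<otimes> inv z"
  have "?h \<otimes> z = a \<ominus> b \<oplus> c"
    using z abc by (simp add: right_truss_distribD m_assoc)
  then have "(a \<ominus> b \<oplus> c) \<otimes> inv z = ?h \<otimes> z \<otimes> inv z"
    by simp
  also have "\<dots> = ?h"
    using z abc by (simp add: m_assoc)
  finally show "(a \<ominus> b \<oplus> c) \<otimes> inv z = ?h" .
qed

text \<open>The two right multiplications differ by the left translation by \<open>d\<close>, and
  heap morphisms are stable under translation: in the ternary operation the \<open>d\<close> of the
  negated middle term meets that of the third, and the leading \<open>d\<close> cancels on the
  left.\<close>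

lemma right_truss_distrib_translate:
  assumes z: "right_truss_distrib z" "z \<in> carrier B"
    and w: "w \<in> carrier B"
    and d: "d \<in> carrier B" "\<And>a. a \<in> carrier B \<Longrightarrow> a \<otimes> z \<ominus> a \<otimes> w = d"
  shows "right_truss_distrib w"
  unfolding right_truss_distrib_def
proof (intro ballI)
  fix a b c
  assume abc: "a \<in> carrier B" "b \<in> carrier B" "c \<in> carrier B"
  have z_eq: "x \<otimes> z = d \<oplus> x \<otimes> w" if x: "x \<in> carrier B" for x
    using x z(2) w by (simp add: a_minus_def add.m_assoc flip: d(2)[OF x])
  have "d \<oplus> (a \<ominus> b \<oplus> c) \<otimes> w = d \<oplus> (a \<otimes> w \<ominus> b \<otimes> w \<oplus> c \<otimes> w)"
    using right_truss_distribD[OF z(1) abc] abc w d(1)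
    by (simp add: z_eq a_minus_def add.m_assoc add.inv_mult_group)
  then show "(a \<ominus> b \<oplus> c) \<otimes> w = a \<otimes> w \<ominus> b \<otimes> w \<oplus> c \<otimes> w"
    using abc w d(1) by simp
qed

text \<open>Distributing \<open>w\<close> turns the middle factor of the first identity into
  \<open>p \<otimes> w \<ominus> x \<oplus> z \<otimes> w\<close>. Negation reverses the order of
  the summands, so the outer terms cancel against their neighbours. The second identity exchanges
  \<open>p\<close> and \<open>z\<close>.\<close>

lemma sigma_inverse:
  assumes "right_truss_distrib w" "w \<in> carrier B"
    and "p \<in> carrier B" "x \<in> carrier B" "z \<in> carrier B"
  shows "z \<otimes> w \<ominus> (p \<ominus> x \<otimes> inv w \<oplus> z) \<otimes> w \<oplus> p \<otimes> w = x"
    and "p \<otimes> w \<ominus> (z \<ominus> x \<otimes> inv w \<oplus> p) \<otimes> w \<oplus> z \<otimes> w = x"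
  using assms by (simp_all add: right_truss_distribD)
    (simp_all add: a_minus_def m_assoc add.m_assoc add.inv_mult_group)

text \<open>Each map keeps the product of its arguments, so a composite that restores
  \<open>x\<close> has second component \<open>inv x \<otimes> (x \<otimes> y) = y\<close>.\<close>

lemma product_preserving_inverse:
  assumes s: "\<And>x y. \<lbrakk>x \<in> carrier B; y \<in> carrier B\<rbrakk> \<Longrightarrow> s x y \<in> carrier B"
    and t: "\<And>x y. \<lbrakk>x \<in> carrier B; y \<in> carrier B\<rbrakk> \<Longrightarrow> t x y \<in> carrier B"
    and f: "\<And>x y. \<lbrakk>x \<in> carrier B; y \<in> carrier B\<rbrakk> \<Longrightarrow> f (x, y) = (s x y, inv (s x y) \<otimes> x \<otimes> y)"
    and g: "\<And>x y. \<lbrakk>x \<in> carrier B; y \<in> carrier B\<rbrakk> \<Longrightarrow> g (x, y) = (t x y, inv (t x y) \<otimes> x \<otimes> y)"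
    and ts: "\<And>x y. \<lbrakk>x \<in> carrier B; y \<in> carrier B\<rbrakk> \<Longrightarrow> t (s x y) (inv (s x y) \<otimes> x \<otimes> y) = x"
    and st: "\<And>x y. \<lbrakk>x \<in> carrier B; y \<in> carrier B\<rbrakk> \<Longrightarrow> s (t x y) (inv (t x y) \<otimes> x \<otimes> y) = x"
  shows "is_inverse_map_on (carrier B \<times> carrier B) f g"
proof (subst is_inverse_map_on_iff)
  show "\<forall>p \<in> carrier B \<times> carrier B. g (f p) = p \<and> f (g p) = p"
    using s t ts st by (auto simp: f g m_assoc)
qed (use s t in \<open>auto simp: f g\<close>)

end

theorem proposition2p23:
  fixes B (structure)
    and \<sigma> \<tau> \<sigma>h \<tau>h :: "'a \<Rightarrow> 'a \<Rightarrow> 'a"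
    and r rs :: "'a \<times> 'a \<Rightarrow> 'a \<times> 'a"
  assumes "near_brace B"
    and rs_def: "rs = (\<lambda>(x, y). (\<sigma>h x y, \<tau>h y x))"
    and r_def: "r = (\<lambda>(x, y). (\<sigma> x y, \<tau> y x))"
    and rs_sol: "braid_solution (carrier B) rs"
    and r_sol: "braid_solution (carrier B) r"
  shows
    "(is_inverse_map_on (carrier B \<times> carrier B) r rs \<longleftrightarrow>
       (\<forall>x \<in> carrier B. \<forall>y \<in> carrier B.
          \<sigma>h (\<sigma> x y) (\<tau> y x) = x \<and> \<tau>h (\<tau> y x) (\<sigma> x y) = y \<and>
          \<sigma> (\<sigma>h x y) (\<tau>h y x) = x \<and> \<tau> (\<tau>h y x) (\<sigma>h x y) = y))
     \<and>
     (\<forall>\<xi> \<in> carrier B. \<forall>z1 \<in> carrier B. \<forall>z2 \<in> carrier B.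
        (\<exists>c1 \<in> carrier B. \<exists>c2 \<in> carrier B.
          \<forall>a \<in> carrier B. \<forall>b \<in> carrier B. \<forall>c \<in> carrier B.
            (\<forall>z \<in> {z1, z2}. (a \<ominus> b \<oplus> c) \<otimes> z = a \<otimes> z \<ominus> b \<otimes> z \<oplus> c \<otimes> z) \<and>
            a \<otimes> z2 \<otimes> z1 \<ominus> a \<otimes> \<xi> = c1 \<and>
            \<ominus> (a \<otimes> \<xi>) \<oplus> a \<otimes> z1 \<otimes> z2 = c2) \<longrightarrow>
        (\<forall>x \<in> carrier B. \<forall>y \<in> carrier B.
            \<sigma> x y = x \<otimes> y \<otimes> z1 \<ominus> x \<otimes> \<xi> \<oplus> z2 \<and>
            \<tau> y x = inv (\<sigma> x y) \<otimes> x \<otimes> y) \<longrightarrow>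
        (let \<xi>' = inv \<xi>;
             z1' = z1 \<otimes> inv \<xi>;
             z2' = z2 \<otimes> inv \<xi>;
             \<sigma>' = (\<lambda>x y. z2' \<ominus> x \<otimes> \<xi>' \<oplus> x \<otimes> y \<otimes> z1');
             \<tau>' = (\<lambda>y x. inv (\<sigma>' x y) \<otimes> x \<otimes> y)
         in is_inverse_map_on (carrier B \<times> carrier B) r (\<lambda>(x, y). (\<sigma>' x y, \<tau>' y x))))"
proof -
  interpret near_brace B by fact
  let ?C = "carrier B"
  \<comment> \<open>The notion of a braid solution includes closure of the carrier, as the
    composition criterion requires.\<close>
  have "r \<in> ?C \<times> ?C \<rightarrow> ?C \<times> ?C" "rs \<in> ?C \<times> ?C \<rightarrow> ?C \<times> ?C"
    using r_sol rs_sol by (simp_all add: braid_solution_def)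
  then have part1: "is_inverse_map_on (?C \<times> ?C) r rs \<longleftrightarrow>
      (\<forall>x \<in> ?C. \<forall>y \<in> ?C.
        \<sigma>h (\<sigma> x y) (\<tau> y x) = x \<and> \<tau>h (\<tau> y x) (\<sigma> x y) = y \<and>
        \<sigma> (\<sigma>h x y) (\<tau>h y x) = x \<and> \<tau> (\<tau>h y x) (\<sigma>h x y) = y)"
    by (auto simp: is_inverse_map_on_iff rs_def r_def)
  have part2: "is_inverse_map_on (?C \<times> ?C) r
      (\<lambda>(x, y). (s' x y, inv (s' x y) \<otimes> x \<otimes> y))"
    if z: "\<xi> \<in> ?C" "z1 \<in> ?C" "z2 \<in> ?C"
      and c1: "c1 \<in> ?C" "\<And>a. a \<in> ?C \<Longrightarrow> a \<otimes> z2 \<otimes> z1 \<ominus> a \<otimes> \<xi> = c1"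
      and dist: "right_truss_distrib z1" "right_truss_distrib z2"
      and \<sigma>: "\<And>x y. \<lbrakk>x \<in> ?C; y \<in> ?C\<rbrakk> \<Longrightarrow> \<sigma> x y = x \<otimes> y \<otimes> z1 \<ominus> x \<otimes> \<xi> \<oplus> z2"
      and \<tau>: "\<And>x y. \<lbrakk>x \<in> ?C; y \<in> ?C\<rbrakk> \<Longrightarrow> \<tau> y x = inv (\<sigma> x y) \<otimes> x \<otimes> y"
      and s': "s' = (\<lambda>x y. z2 \<otimes> inv \<xi> \<ominus> x \<otimes> inv \<xi> \<oplus> x \<otimes> y \<otimes> (z1 \<otimes> inv \<xi>))"
    for \<xi> z1 z2 c1 s'
  proof -
    \<comment> \<open>\<open>z2 \<otimes> z1\<close> inherits the property from its factors, and
      \<open>\<xi>\<close> differs from it by the translation by \<open>c1\<close>, which is the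
      same for all \<open>a\<close>.\<close>
    have \<xi>: "right_truss_distrib \<xi>"
      using right_truss_distrib_mult[OF dist(2,1)] z c1
      by (intro right_truss_distrib_translate[of "z2 \<otimes> z1" \<xi> c1]) (simp_all flip: m_assoc)
    show ?thesis
    proof (rule product_preserving_inverse[where s = \<sigma> and t = s'])
      fix x y
      assume xy: "x \<in> ?C" "y \<in> ?C"
      show \<sigma>_in: "\<sigma> x y \<in> ?C" and s'_in: "s' x y \<in> ?C"
        using xy z by (simp_all add: \<sigma> s')
      show "r (x, y) = (\<sigma> x y, inv (\<sigma> x y) \<otimes> x \<otimes> y)"
        using xy by (simp add: r_def \<tau>)
      \<comment> \<open>In \<open>\<sigma>\<close> and \<open>s'\<close> the second argument occurs
        only in the product of both arguments, so after either map this product can be replaced by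
        \<open>x \<otimes> y\<close>.\<close>
      have "u \<otimes> (inv u \<otimes> x \<otimes> y) = x \<otimes> y" if "u \<in> ?C" for u
        using that xy by (simp add: m_assoc)
      note prod = this[OF \<sigma>_in] this[OF s'_in]
      show "s' (\<sigma> x y) (inv (\<sigma> x y) \<otimes> x \<otimes> y) = x"
        \<comment> \<open>With \<open>w = inv \<xi>\<close> the term
          \<open>x \<otimes> inv w\<close> is \<open>x \<otimes> \<xi>\<close>, so the middle factor
          is exactly \<open>\<sigma> x y\<close>.\<close>
        using sigma_inverse(1)[OF right_truss_distrib_inv[OF \<xi>], of "x \<otimes> y \<otimes> z1" x z2] xy z
        unfolding s' prod by (simp add: \<sigma> m_assoc)
      have "\<sigma> (s' x y) (inv (s' x y) \<otimes> x \<otimes> y) = x \<otimes> y \<otimes> z1 \<ominus> s' x y \<otimes> \<xi> \<oplus> z2"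
        using s'_in xy by (simp add: \<sigma> prod)
      also have "\<dots> = x"
        \<comment> \<open>Now \<open>w = \<xi>\<close>. The instances carry a factor
          \<open>inv \<xi>\<close>, so that the middle factor is \<open>s' x y\<close> and the outer
          terms reduce to \<open>x \<otimes> y \<otimes> z1\<close> and \<open>z2\<close>.\<close>
        using sigma_inverse(2)[OF \<xi>, of "x \<otimes> y \<otimes> z1 \<otimes> inv \<xi>" x "z2 \<otimes> inv \<xi>"] xy z
        by (simp add: s' m_assoc)
      finally show "\<sigma> (s' x y) (inv (s' x y) \<otimes> x \<otimes> y) = x" .
    qed simp
  qed
  show ?thesis
    unfolding Let_def
  proof (intro conjI ballI impI, rule part1)
    fix \<xi> z1 z2
    assume z: "\<xi> \<in> ?C" "z1 \<in> ?C" "z2 \<in> ?C"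
      and ex: "\<exists>c1 \<in> ?C. \<exists>c2 \<in> ?C. \<forall>a \<in> ?C. \<forall>b \<in> ?C. \<forall>c \<in> ?C.
        (\<forall>z \<in> {z1, z2}. (a \<ominus> b \<oplus> c) \<otimes> z = a \<otimes> z \<ominus> b \<otimes> z \<oplus> c \<otimes> z) \<and>
        a \<otimes> z2 \<otimes> z1 \<ominus> a \<otimes> \<xi> = c1 \<and> \<ominus> (a \<otimes> \<xi>) \<oplus> a \<otimes> z1 \<otimes> z2 = c2"
      and \<sigma>\<tau>: "\<forall>x \<in> ?C. \<forall>y \<in> ?C. \<sigma> x y = x \<otimes> y \<otimes> z1 \<ominus> x \<otimes> \<xi> \<oplus> z2 \<and>
        \<tau> y x = inv (\<sigma> x y) \<otimes> x \<otimes> y"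
    from ex obtain c1 where c1: "c1 \<in> ?C" "\<And>a. a \<in> ?C \<Longrightarrow> a \<otimes> z2 \<otimes> z1 \<ominus> a \<otimes> \<xi> = c1"
      by blast
    have "right_truss_distrib z1" "right_truss_distrib z2"
      using ex by (auto simp: right_truss_distrib_def)
    then show "is_inverse_map_on (?C \<times> ?C) r
        (\<lambda>(x, y). (z2 \<otimes> inv \<xi> \<ominus> x \<otimes> inv \<xi> \<oplus> x \<otimes> y \<otimes> (z1 \<otimes> inv \<xi>),
          inv (z2 \<otimes> inv \<xi> \<ominus> x \<otimes> inv \<xi> \<oplus> x \<otimes> y \<otimes> (z1 \<otimes> inv \<xi>)) \<otimes> x \<otimes> y))"
      using \<sigma>\<tau> by (intro part2[OF z c1]) simp_all
  qed
qed

end
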